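(* Let $d\ge 1$, let $\mathcal{A}\subset\mathbb{Z}^d$ be a finite nonempty set, and let $\mathcal{V}:=\mathrm{Conv}(\mathcal{A})\cap\mathbb{Z}^d$. Consider the integer linear program in the variables $x_v$ ($v\in\mathcal{V}$) and $y_{vw}$ ($v,w\in\mathcal{V}$): $$\text{maximize } |\mathcal{A}|+\sum_{v\in\mathcal{V}\setminus\mathcal{A}}x_v$$ subject to - $\sum_{v\in\mathcal{V}}y_{vw}\le|\mathcal{V}|\,x_w$ for all $w\in\mathcal{V}$; - $\sum_{w\in\mathcal{V}}y_{vw}\le|\mathcal{V}|\,x_v$ for all $v\in\mathcal{A}$; - $y_{v(2v-w)}\ge y_{vw}$ for all $v\neq w$ in $\mathcal{V}$ with $2v-w\in\mathcal{V}$; - $y_{vw}=0$ for all $v\ne w$ in $\mathcal{V}$ with $2v-w\notin\mathcal{V}$; - $\sum_{w\in\mathcal{V}}y_{vw}=2x_v$ for all $v\in\mathcal{V}\setminus\mathcal{A}$; - $x_v=1$ for all $v\in\mathcal{A}$; - $x_v\in\{0,1\}$ for all $v\in\mathcal{V}$, and $y_{vw}\in\{0,1\}$ for all $v,w\in\mathcal{V}$. This program computes a maximal $\mathcal{A}$-mediated graph in the domain $\mathbb{Z}^d$: it has an optimal solution, and for every optimal solution $(x,y)$ the digraph with vertex set $\{v\in\mathcal{V}:x_v=1\}$ and arc set $\{(v,w):v\in\mathcal{V}\setminus\mathcal{A},\ w\in\mathcal{V},\ y_{vw}=1\}$ belongs to $\mathrm{MaxMG}_{\mathcal{A}}$.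
   Context: Mediated graphs in the domain $\mathbb{Z}^d$: for a finite nonempty set $\mathcal{A}\subset\mathbb{Z}^d$, an $\mathcal{A}$-mediated graph is a finite digraph $G=(V,E)$ with $\mathcal{A}\subset V\subset\mathbb{Z}^d$, $E\subset V\times V$, such that, writing $\delta^+(v)=\{w\in V:(v,w)\in E\}$, for every $v\in V\setminus\mathcal{A}$: $\delta^+(v)\ne\emptyset$, and $w\in\delta^+(v)$ implies $2v-w\in\delta^+(v)$. By standing convention mediated graphs are taken in reduced form: $|\delta^+(v)|=2$ for all $v\in V\setminus\mathcal{A}$ (so $\delta^+(v)=\{w,2v-w\}$ with $w\neq v$, and there are no loops) and $\delta^+(a)=\emptyset$ for $a\in\mathcal{A}$. $\mathcal{M}_{\mathcal{A}}$ is the set of all $\mathcal{A}$-mediated graphs in the domain $\mathbb{Z}^d$. $\mathrm{MaxMG}_{\mathcal{A}}$ is the set of those $(V,E)\in\mathcal{M}_{\mathcal{A}}$ for which there is no $(V',E')\in\mathcal{M}_{\mathcal{A}}$ with $|V'|>|V|$. $\mathrm{Conv}$ denotes the convex hull. *)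

theory Defs
  imports "HOL-Analysis.Analysis"
begin

text \<open>Digraphs are pairs (V, E) of a vertex set and an arc set; loops are not excluded a priori.\<close>

type_synonym 'v dgraph = "'v set \<times> ('v \<times> 'v) set"

definition out_nbrs :: "'v dgraph \<Rightarrow> 'v \<Rightarrow> 'v set" where
  "out_nbrs G v = {w \<in> fst G. (v, w) \<in> snd G}"

definition mediated :: "(int ^ 'd) set \<Rightarrow> (int ^ 'd) dgraph \<Rightarrow> bool" where
  "mediated A G \<longleftrightarrow>
     finite (fst G) \<and> A \<subseteq> fst G \<and> snd G \<subseteq> fst G \<times> fst G \<and>
     (\<forall>v \<in> fst G - A. out_nbrs G v \<noteq> {} \<and>
        (\<forall>w \<in> out_nbrs G v. 2 *s v - w \<in> out_nbrs G v))"

definition reduced :: "(int ^ 'd) set \<Rightarrow> (int ^ 'd) dgraph \<Rightarrow> bool" where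
  "reduced A G \<longleftrightarrow>
     (\<forall>v \<in> fst G - A. card (out_nbrs G v) = 2) \<and> (\<forall>a \<in> A. out_nbrs G a = {})"

text \<open>Mediated graphs are always taken in reduced form.\<close>

definition MG :: "(int ^ 'd) set \<Rightarrow> (int ^ 'd) dgraph set" where
  "MG A = {G. mediated A G \<and> reduced A G}"

definition MaxMG :: "(int ^ 'd) set \<Rightarrow> (int ^ 'd) dgraph set" where
  "MaxMG A = {G \<in> MG A. \<not> (\<exists>G' \<in> MG A. card (fst G') > card (fst G))}"

definition real_vec :: "int ^ 'd \<Rightarrow> real ^ 'd" where
  "real_vec v = (\<chi> i. real_of_int (v $ i))"

definition lattice_hull :: "(int ^ 'd) set \<Rightarrow> (int ^ 'd) set" where
  "lattice_hull A = {v. real_vec v \<in> convex hull (real_vec ` A)}"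

text \<open>The variables of the program are indexed by \<^term>\<open>lattice_hull A\<close>; the values of
  \<open>x\<close> and \<open>y\<close> elsewhere are irrelevant.\<close>

definition ilp_feasible ::
  "(int ^ 'd) set \<Rightarrow> (int ^ 'd \<Rightarrow> int) \<Rightarrow> (int ^ 'd \<Rightarrow> int ^ 'd \<Rightarrow> int) \<Rightarrow> bool" where
  "ilp_feasible A x y \<longleftrightarrow>
     (let V = lattice_hull A in
      (\<forall>w \<in> V. (\<Sum>v\<in>V. y v w) \<le> int (card V) * x w) \<and>
      (\<forall>v \<in> A. (\<Sum>w\<in>V. y v w) \<le> int (card V) * x v) \<and>
      (\<forall>v \<in> V. \<forall>w \<in> V. v \<noteq> w \<and> 2 *s v - w \<in> V \<longrightarrow> y v (2 *s v - w) \<ge> y v w) \<and>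
      (\<forall>v \<in> V. \<forall>w \<in> V. v \<noteq> w \<and> 2 *s v - w \<notin> V \<longrightarrow> y v w = 0) \<and>
      (\<forall>v \<in> V - A. (\<Sum>w\<in>V. y v w) = 2 * x v) \<and>
      (\<forall>v \<in> A. x v = 1) \<and>
      (\<forall>v \<in> V. x v \<in> {0, 1}) \<and>
      (\<forall>v \<in> V. \<forall>w \<in> V. y v w \<in> {0, 1}))"

definition ilp_objective :: "(int ^ 'd) set \<Rightarrow> (int ^ 'd \<Rightarrow> int) \<Rightarrow> int" where
  "ilp_objective A x = int (card A) + (\<Sum>v \<in> lattice_hull A - A. x v)"

definition ilp_optimal ::
  "(int ^ 'd) set \<Rightarrow> (int ^ 'd \<Rightarrow> int) \<Rightarrow> (int ^ 'd \<Rightarrow> int ^ 'd \<Rightarrow> int) \<Rightarrow> bool" where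
  "ilp_optimal A x y \<longleftrightarrow>
     ilp_feasible A x y \<and>
     (\<forall>x' y'. ilp_feasible A x' y' \<longrightarrow> ilp_objective A x' \<le> ilp_objective A x)"

end

theory Submission imports Defs begin

text \<open>A reduced mediated graph lives inside the lattice hull of \<open>A\<close>: a vertex outside \<open>A\<close> is the
  midpoint of two other vertices, so only points of \<open>A\<close> can be extreme in the convex hull of all
  vertices, and Krein--Milman applies. The 0/1 indicators of vertices and arcs therefore give a
  feasible point whose objective is the number of vertices. Conversely, the support of a feasible
  point is a reduced mediated graph: its arcs at each vertex outside \<open>A\<close> are closed under
  \<open>w \<mapsto> 2v - w\<close>, and their number is fixed to be 2. So the program maximizes the number of vertices.\<close>

section \<open>Finiteness of lattice point sets in bounded regions\<close>

lemma inj_real_vec: "inj real_vec"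
  by (auto simp: inj_def real_vec_def vec_eq_iff)

lemma finite_int_box:
  fixes a b :: int
  shows "finite {v :: int ^ 'd. \<forall>i. a \<le> v $ i \<and> v $ i \<le> b}"
proof -
  have "finite (PiE (UNIV :: 'd set) (\<lambda>_. {a..b}))"
    by (intro finite_PiE) auto
  then have "finite (vec_nth -` PiE (UNIV :: 'd set) (\<lambda>_. {a..b}))"
    by (rule finite_vimageI) (simp add: inj_def vec_eq_iff)
  moreover have "vec_nth -` PiE (UNIV :: 'd set) (\<lambda>_. {a..b}) = {v. \<forall>i. a \<le> v $ i \<and> v $ i \<le> b}"
    by (auto simp: PiE_def Pi_def)
  ultimately show ?thesis
    by simp
qed

text \<open>A norm bound on \<open>S\<close> bounds every coordinate of such a point, so these
  points lie in a finite integer box.\<close>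

lemma finite_real_vec_vimage:
  assumes "bounded S"
  shows "finite {v :: int ^ 'd. real_vec v \<in> S}"
proof -
  obtain B where B: "\<And>x. x \<in> S \<Longrightarrow> norm x \<le> B"
    using assms by (auto simp: bounded_iff)
  have "{v :: int ^ 'd. real_vec v \<in> S} \<subseteq> {v. \<forall>i. - \<lceil>B\<rceil> \<le> v $ i \<and> v $ i \<le> \<lceil>B\<rceil>}"
  proof clarify
    fix v :: "int ^ 'd" and i
    assume "real_vec v \<in> S"
    then have "\<bar>real_vec v $ i\<bar> \<le> B"
      using component_le_norm_cart[of "real_vec v" i] B by fastforce
    then have "\<bar>real_of_int (v $ i)\<bar> \<le> B"
      by (simp add: real_vec_def)
    then show "- \<lceil>B\<rceil> \<le> v $ i \<and> v $ i \<le> \<lceil>B\<rceil>"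
      by linarith
  qed
  then show ?thesis
    by (rule finite_subset[OF _ finite_int_box])
qed

lemma finite_lattice_hull: "finite A \<Longrightarrow> finite (lattice_hull A)"
  unfolding lattice_hull_def
  by (intro finite_real_vec_vimage) (simp add: finite_imp_bounded bounded_convex_hull)

lemma subset_lattice_hull: "A \<subseteq> lattice_hull A"
  by (auto simp: lattice_hull_def intro: hull_inc)

section \<open>Reflections and the location of the vertices of a mediated graph\<close>

lemma reflect_eq_iff:
  fixes v w :: "int ^ 'd"
  shows "2 *s v - w = v \<longleftrightarrow> w = v" "2 *s v - w = w \<longleftrightarrow> w = v"
  by (auto simp: vec_eq_iff)

text \<open>The point is the midpoint of the two ends, and \<open>w \<noteq> v\<close> keeps the
  segment from being degenerate. This is the form in which non-extremality is refuted later.\<close>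

lemma real_vec_in_open_segment:
  assumes "w \<noteq> v"
  shows "real_vec v \<in> open_segment (real_vec w) (real_vec (2 *s v - w))"
proof -
  have "real_vec v = midpoint (real_vec w) (real_vec (2 *s v - w))"
    by (simp add: midpoint_def real_vec_def vec_eq_iff)
  moreover have "real_vec w \<noteq> real_vec (2 *s v - w)"
    using assms reflect_eq_iff(2)[of v w] injD[OF inj_real_vec, of w "2 *s v - w"] by auto
  ultimately show ?thesis
    by simp
qed

text \<open>Since vertices in \<open>A\<close> have no out-neighbours, every arc starts outside
  \<open>A\<close>. Hence reflection applies to each arc without a side condition on its
  tail.\<close>

lemma MG_D:
  assumes "G \<in> MG A"
  shows "finite (fst G)" "A \<subseteq> fst G" "snd G \<subseteq> (fst G - A) \<times> fst G"
    "\<And>v. v \<in> fst G - A \<Longrightarrow> card (out_nbrs G v) = 2"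
    "\<And>v w. (v, w) \<in> snd G \<Longrightarrow> (v, 2 *s v - w) \<in> snd G"
proof -
  show fin: "finite (fst G)" and sub: "A \<subseteq> fst G"
    and deg: "\<And>v. v \<in> fst G - A \<Longrightarrow> card (out_nbrs G v) = 2"
    using assms by (auto simp: MG_def mediated_def reduced_def)
  have arcs_V: "snd G \<subseteq> fst G \<times> fst G" and no_out: "\<And>a. a \<in> A \<Longrightarrow> out_nbrs G a = {}"
    and refl: "\<And>v w. v \<in> fst G - A \<Longrightarrow> w \<in> out_nbrs G v \<Longrightarrow> 2 *s v - w \<in> out_nbrs G v"
    using assms by (simp_all add: MG_def mediated_def reduced_def)
  have arc: "v \<in> fst G - A \<and> w \<in> out_nbrs G v" if "(v, w) \<in> snd G" for v w
    using that arcs_V no_out[of v] by (auto simp: out_nbrs_def)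
  then show "snd G \<subseteq> (fst G - A) \<times> fst G"
    by (auto simp: out_nbrs_def)
  show "(v, 2 *s v - w) \<in> snd G" if "(v, w) \<in> snd G" for v w
    using refl[of v w] arc[OF that] by (simp add: out_nbrs_def)
qed

lemma MG_vertices_subset_lattice_hull:
  assumes "G \<in> MG A"
  shows "fst G \<subseteq> lattice_hull A"
proof -
  let ?H = "convex hull (real_vec ` fst G)"
  have "p \<in> real_vec ` A" if ext: "p extreme_point_of ?H" for p
  proof (rule ccontr)
    assume "p \<notin> real_vec ` A"
    moreover obtain v where v: "v \<in> fst G" "p = real_vec v"
      using extreme_point_of_convex_hull[OF ext] by auto
    ultimately have "card (out_nbrs G v) = 2"
      using MG_D(4)[OF assms, of v] by auto
    \<comment> \<open>Loops are not excluded by the definition of a digraph; out-degree 2 still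
      supplies a neighbour other than \<open>v\<close>.\<close>
    then have "\<not> out_nbrs G v \<subseteq> {v}"
      using card_mono[of "{v}" "out_nbrs G v"] by auto
    then obtain w where w: "(v, w) \<in> snd G" "w \<noteq> v"
      by (auto simp: out_nbrs_def)
    then have "w \<in> fst G" "2 *s v - w \<in> fst G"
      using MG_D(3,5)[OF assms] by blast+
    then have "real_vec w \<in> ?H" "real_vec (2 *s v - w) \<in> ?H"
      by (simp_all add: hull_inc)
    then show False
      using ext real_vec_in_open_segment[OF w(2)] v(2)
      unfolding extreme_point_of_def by blast
  qed
  \<comment> \<open>A compact convex set is the hull of its extreme points, all of which now come
    from \<open>A\<close>.\<close>
  moreover have "?H = convex hull {p. p extreme_point_of ?H}"
    using MG_D(1)[OF assms]
    by (intro Krein_Milman_Minkowski) (simp_all add: finite_imp_compact compact_convex_hull)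
  ultimately have "?H \<subseteq> convex hull (real_vec ` A)"
    by (metis hull_mono mem_Collect_eq subsetI)
  then show ?thesis
    unfolding lattice_hull_def using hull_subset[of "real_vec ` fst G" convex] by blast
qed

section \<open>From mediated graphs to feasible points, and the objective as a vertex count\<close>

lemma sum_01_eq_card:
  fixes f :: "'a \<Rightarrow> int"
  assumes "finite V" "\<And>v. v \<in> V \<Longrightarrow> f v \<in> {0, 1}"
  shows "sum f V = int (card {v \<in> V. f v = 1})"
proof -
  have "sum f V = (\<Sum>v\<in>V. of_bool (f v = 1))"
    using assms(2) by (intro sum.cong) force+
  then show ?thesis
    using assms(1) by (simp add: Int_def)
qed

lemma ilp_feasible_indicator:
  assumes "finite A" and G: "G \<in> MG A"
  shows "ilp_feasible A (\<lambda>v. of_bool (v \<in> fst G)) (\<lambda>v w. of_bool ((v, w) \<in> snd G))"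
    (is "ilp_feasible A ?x ?y")
proof -
  let ?V = "lattice_hull A"
  note fin = finite_lattice_hull[OF assms(1)]
  note GV = MG_vertices_subset_lattice_hull[OF G]
  have arcs: "v \<in> fst G - A" "w \<in> fst G" "(v, 2 *s v - w) \<in> snd G" if "(v, w) \<in> snd G" for v w
    using MG_D(3,5)[OF G] that by blast+
  have out: "(\<Sum>w\<in>?V. ?y v w) = int (card (out_nbrs G v))" for v
  proof -
    have "{w \<in> ?V. (v, w) \<in> snd G} = out_nbrs G v"
      using GV arcs by (auto simp: out_nbrs_def)
    then show ?thesis
      using fin by (simp add: Int_def)
  qed
  have "(\<Sum>v\<in>?V. ?y v w) \<le> int (card ?V) * ?x w" for w
  proof (cases "w \<in> fst G")
    case True
    \<comment> \<open>The factor \<open>card ?V\<close> is a big-M constant: at a chosen vertex the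
      constraint is vacuous for 0/1 values.\<close>
    have "(\<Sum>v\<in>?V. ?y v w) \<le> (\<Sum>v\<in>?V. 1)"
      by (intro sum_mono) auto
    then show ?thesis using True by simp
  next
    case False
    then have "(\<Sum>v\<in>?V. ?y v w) = 0"
      by (intro sum.neutral) (auto dest: arcs)
    then show ?thesis using False by simp
  qed
  \<comment> \<open>This covers both the points of \<open>A\<close>, where the sum need only be
    bounded, and the non-vertices, where it must equal \<open>2 * 0\<close>.\<close>
  moreover have "(\<Sum>w\<in>?V. ?y v w) = 0" if "v \<notin> fst G - A" for v
    using that arcs by (intro sum.neutral) auto
  moreover have "(\<Sum>w\<in>?V. ?y v w) = 2" if "v \<in> fst G - A" for v
    using MG_D(4)[OF G that] out by simp
  moreover have "2 *s v - w \<in> ?V" if "(v, w) \<in> snd G" for v w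
    using arcs that GV by blast
  ultimately show ?thesis
    using MG_D(2)[OF G] arcs(3) unfolding ilp_feasible_def Let_def
    by (auto simp: of_bool_def)
qed

text \<open>As \<open>x\<close> is 1 on \<open>A\<close>, the constant \<open>card A\<close> is the
  missing part of the sum over the whole hull.\<close>

lemma ilp_objective_eq_card:
  assumes "finite A" "\<And>v. v \<in> A \<Longrightarrow> x v = 1" "\<And>v. v \<in> lattice_hull A \<Longrightarrow> x v \<in> {0, 1}"
  shows "ilp_objective A x = int (card {v \<in> lattice_hull A. x v = 1})"
proof -
  have "(\<Sum>v\<in>lattice_hull A. x v) = (\<Sum>v\<in>lattice_hull A - A. x v) + (\<Sum>v\<in>A. x v)"
    by (rule sum.subset_diff[OF subset_lattice_hull finite_lattice_hull[OF assms(1)]])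
  moreover have "(\<Sum>v\<in>A. x v) = int (card A)"
    using assms(2) by simp
  ultimately have "ilp_objective A x = (\<Sum>v\<in>lattice_hull A. x v)"
    by (simp add: ilp_objective_def)
  then show ?thesis
    using sum_01_eq_card[OF finite_lattice_hull[OF assms(1)] assms(3)] by simp
qed

lemma ilp_objective_indicator:
  assumes "finite A" "G \<in> MG A"
  shows "ilp_objective A (\<lambda>v. of_bool (v \<in> fst G)) = int (card (fst G))"
proof -
  have "{v \<in> lattice_hull A. (of_bool (v \<in> fst G) :: int) = 1} = fst G"
    using MG_vertices_subset_lattice_hull[OF assms(2)] by auto
  then show ?thesis
    using MG_D(2)[OF assms(2)] by (subst ilp_objective_eq_card[OF assms(1)]) auto
qed

section \<open>From feasible points to mediated graphs\<close>

lemma feasible_support_in_MG: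
  assumes "finite A" "ilp_feasible A x y"
  shows "({v \<in> lattice_hull A. x v = 1},
    {(v, w). v \<in> lattice_hull A - A \<and> w \<in> lattice_hull A \<and> y v w = 1}) \<in> MG A"
    (is "(?W, ?E) \<in> MG A")
proof -
  let ?V = "lattice_hull A"
  note fin = finite_lattice_hull[OF assms(1)]
  have ins: "(\<Sum>v\<in>?V. y v w) \<le> int (card ?V) * x w" if "w \<in> ?V" for w
    using assms(2) that by (simp add: ilp_feasible_def Let_def)
  have refl: "y v w \<le> y v (2 *s v - w)" if "v \<in> ?V" "w \<in> ?V" "v \<noteq> w" "2 *s v - w \<in> ?V" for v w
    using assms(2) that by (simp add: ilp_feasible_def Let_def)
  have refl0: "y v w = 0" if "v \<in> ?V" "w \<in> ?V" "v \<noteq> w" "2 *s v - w \<notin> ?V" for v w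
    using assms(2) that by (simp add: ilp_feasible_def Let_def)
  have outs: "(\<Sum>w\<in>?V. y v w) = 2 * x v" if "v \<in> ?V - A" for v
    using assms(2) that by (simp add: ilp_feasible_def Let_def)
  have xA: "x v = 1" if "v \<in> A" for v
    using assms(2) that by (simp add: ilp_feasible_def Let_def)
  have x01: "x v = 0 \<or> x v = 1" if "v \<in> ?V" for v
    using assms(2) that by (simp add: ilp_feasible_def Let_def)
  have y01: "y v w \<in> {0, 1}" if "v \<in> ?V" "w \<in> ?V" for v w
    using assms(2) that by (simp add: ilp_feasible_def Let_def)
  have y0: "0 \<le> y v w" if "v \<in> ?V" "w \<in> ?V" for v w
    using y01[OF that] by auto
  \<comment> \<open>A single arc makes the out-sum at its tail and the in-sum at its head positive,
    so neither \<open>x\<close> value can be 0. Both ends of each arc are thus chosen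
    vertices.\<close>
  have arc: "x v = 1" "x w = 1" if "v \<in> ?V - A" "w \<in> ?V" "y v w = 1" for v w
  proof -
    have "y v w \<le> (\<Sum>w\<in>?V. y v w)"
      using that y0 fin by (intro member_le_sum) auto
    then show "x v = 1"
      using outs[OF that(1)] x01[of v] that by auto
    have "y v w \<le> (\<Sum>v\<in>?V. y v w)"
      using that y0 fin by (intro member_le_sum[where f = "\<lambda>v. y v w"]) auto
    then show "x w = 1"
      using ins[OF that(2)] x01[OF that(2)] that by auto
  qed
  have nbrs: "out_nbrs (?W, ?E) v = {w \<in> ?V. y v w = 1}" if "v \<in> ?V - A" for v
    using that arc by (auto simp: out_nbrs_def)
  have deg: "card (out_nbrs (?W, ?E) v) = 2" if "v \<in> ?W - A" for v
  proof -
    have "v \<in> ?V - A" using that by auto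
    then have "int (card (out_nbrs (?W, ?E) v)) = 2 * x v"
      using nbrs[of v] outs[of v] sum_01_eq_card[OF fin, of "y v"] y01 by simp
    then show ?thesis using that by simp
  qed
  have closed: "2 *s v - w \<in> out_nbrs (?W, ?E) v"
    if v: "v \<in> ?W - A" and w: "w \<in> out_nbrs (?W, ?E) v" for v w
  \<comment> \<open>The reflection constraints only concern \<open>w \<noteq> v\<close>; a loop is
    its own reflection.\<close>
  proof (cases "w = v")
    case True
    then show ?thesis
      using w reflect_eq_iff(1)[of v v] by metis
  next
    case False
    have "v \<in> ?V - A" using v by auto
    note N = nbrs[OF this]
    have vw: "v \<in> ?V" "w \<in> ?V" "y v w = 1"
      using v w N by auto
    \<comment> \<open>Otherwise the vanishing constraint would contradict
      \<open>y v w = 1\<close>.\<close>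
    then have V: "2 *s v - w \<in> ?V"
      using refl0[of v w] False by auto
    then have "y v (2 *s v - w) = 1"
      using refl[of v w] y01[of v "2 *s v - w"] vw False by auto
    then show ?thesis
      using N V by simp
  qed
  have "mediated A (?W, ?E)"
    unfolding mediated_def
  proof (intro conjI ballI)
    show "finite (fst (?W, ?E))" using fin by simp
    show "A \<subseteq> fst (?W, ?E)" using xA subset_lattice_hull by auto
    show "snd (?W, ?E) \<subseteq> fst (?W, ?E) \<times> fst (?W, ?E)" using arc by auto
  next
    fix v assume v: "v \<in> fst (?W, ?E) - A"
    then show "out_nbrs (?W, ?E) v \<noteq> {}" using deg[of v] by force
    show "2 *s v - w \<in> out_nbrs (?W, ?E) v" if "w \<in> out_nbrs (?W, ?E) v" for w
      using closed v that by simp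
  qed
  moreover have "reduced A (?W, ?E)"
    unfolding reduced_def
  proof (intro conjI ballI)
    show "card (out_nbrs (?W, ?E) v) = 2" if "v \<in> fst (?W, ?E) - A" for v
      using deg that by simp
    show "out_nbrs (?W, ?E) a = {}" if "a \<in> A" for a
      using that by (simp add: out_nbrs_def)
  qed
  ultimately show ?thesis
    by (simp add: MG_def)
qed

section \<open>Existence and maximality of optimal solutions\<close>

lemma ilp_objective_feasible:
  assumes "finite A" "ilp_feasible A x y"
  shows "ilp_objective A x = int (card {v \<in> lattice_hull A. x v = 1})"
  using assms(2) by (intro ilp_objective_eq_card[OF assms(1)]) (auto simp: ilp_feasible_def Let_def)

lemma ex_ilp_optimal:
  assumes "finite A"
  shows "\<exists>x y. ilp_optimal A x y"
proof -
  \<comment> \<open>The values of \<open>x\<close> and \<open>y\<close> off the hull are free, so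
    there may be infinitely many feasible pairs. The maximum is therefore taken over attained
    objective values, which are natural numbers bounded by the size of the hull.\<close>
  define P where "P = (\<lambda>n. \<exists>x y. ilp_feasible A x y \<and> ilp_objective A x = int n)"
  \<comment> \<open>The arcless graph on \<open>A\<close> shows that some value is attained.\<close>
  have "(A, {}) \<in> MG A"
    using assms by (simp add: MG_def mediated_def reduced_def out_nbrs_def)
  then have "P (card A)"
    using ilp_feasible_indicator[OF assms] ilp_objective_indicator[OF assms] unfolding P_def
    by (metis fst_conv)
  moreover have "\<forall>n. P n \<longrightarrow> n \<le> card (lattice_hull A)"
    using finite_lattice_hull[OF assms] ilp_objective_feasible[OF assms]
    by (auto simp: P_def intro: card_mono)
  ultimately obtain n where n: "P n" "\<And>m. P m \<Longrightarrow> m \<le> n"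
    using GreatestI_nat[of P] Greatest_le_nat[of P] by metis
  from n(1) obtain x y where xy: "ilp_feasible A x y" "ilp_objective A x = int n"
    by (auto simp: P_def)
  have "ilp_objective A x' \<le> ilp_objective A x" if "ilp_feasible A x' y'" for x' y'
    using n(2) that xy(2) ilp_objective_feasible[OF assms that] by (auto simp: P_def)
  then show ?thesis
    using xy(1) by (auto simp: ilp_optimal_def)
qed

theorem theorem9:
  fixes A :: "(int ^ 'd) set"
  assumes "finite A" and "A \<noteq> {}"
  shows "(\<exists>x y. ilp_optimal A x y) \<and>
    (\<forall>x y. ilp_optimal A x y \<longrightarrow>
       ({v \<in> lattice_hull A. x v = 1},
        {(v, w). v \<in> lattice_hull A - A \<and> w \<in> lattice_hull A \<and> y v w = 1}) \<in> MaxMG A)"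
proof (intro conjI allI impI)
  show "\<exists>x y. ilp_optimal A x y"
    by (rule ex_ilp_optimal[OF assms(1)])
next
  fix x y
  assume opt: "ilp_optimal A x y"
  then have feas: "ilp_feasible A x y"
    by (simp add: ilp_optimal_def)
  have "card (fst G) \<le> card {v \<in> lattice_hull A. x v = 1}" if G: "G \<in> MG A" for G
  proof -
    \<comment> \<open>The optimum is compared with the indicator solution of
      \<open>G\<close>.\<close>
    have "int (card (fst G)) \<le> ilp_objective A x"
      using opt ilp_feasible_indicator[OF assms(1) G] ilp_objective_indicator[OF assms(1) G]
      unfolding ilp_optimal_def by metis
    then show ?thesis
      by (simp add: ilp_objective_feasible[OF assms(1) feas])
  qed
  then show "({v \<in> lattice_hull A. x v = 1},
      {(v, w). v \<in> lattice_hull A - A \<and> w \<in> lattice_hull A \<and> y v w = 1}) \<in> MaxMG A"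
    using feasible_support_in_MG[OF assms(1) feas] by (auto simp: MaxMG_def not_less)
qed

end
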